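(* Let $d\ge 2$, let $C=\prod_{i=1}^d[l_i,u_i]\subset\mathbb{R}^d$, let $M>0$, and let $f:C\to\mathbb{R}$ have a global minimizer $x^*\in C$ such that $$f(x)-f(x^* )=\left(\frac{M}{2}+\delta(x)\right)\|x-x^*\|^2\quad\text{with}\quad |\delta(x)|\le\Delta=\frac{M}{16(d-1)}\qquad\text{for all }x\in C,$$ where $\|\cdot\|$ is the Euclidean norm. Then the Direction BBS algorithm (described in the context, run without its stopping rule) converges to the global minimum of $f$ on $C$, i.e. the centers $\frac{b+B}{2}$ of the boxes it generates converge to $x^*$. Moreover, at each outer iteration the maximum edge length $\max_i (B_i-b_i)$ of the current box decreases by at least a factor of $\frac32$.
   Context: Direction BBS algorithm. Set $n:=15$ and initialize $b:=l=(l_1,\dots,l_d)$, $B:=u=(u_1,\dots,u_d)$, $m:=\frac{l+u}{2}\in\mathbb{R}^d$. The current box is $\prod_{j=1}^d[b_j,B_j]$. The algorithm repeats outer iterations; one outer iteration consists of performing, for $i=1,\dots,d$ in this order, the following inner step (always with the current values of $b,B,m$): 1. $R:=\max_{k\in\{1,\dots,d\}}(B_k-b_k)$. 2. $j^*\in\arg\min_{j\in\{0,\dots,n\}} f\left(m_1,\dots,m_{i-1},\ b_i+j\frac{B_i-b_i}{n},\ m_{i+1},\dots,m_d\right)$ (ties broken arbitrarily). 3. $m_i:=b_i+j^*\frac{B_i-b_i}{n}$. 4. $b_i:=\max\left(b_i,\ m_i-\frac{R}{3}\right)$ and $B_i:=\min\left(B_i,\ m_i+\frac{R}{3}\right)$.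 The algorithm only uses values of $f$; the function $\delta$ is otherwise arbitrary (no continuity is assumed). *)

theory Defs
  imports "HOL-Analysis.Analysis"
begin

text \<open>
  Points of \<open>\<real>\<^sup>d\<close> are vectors of type \<^typ>\<open>real ^ 'd\<close>.  The coordinates are visited in a fixed order,
  so the index type is required to be a finite linear order; its increasing enumeration plays the
  role of \<open>1, \<dots>, d\<close>.
\<close>

record 'd bbs_state =
  lower :: "real ^ 'd::finite"
  upper :: "real ^ 'd"
  point :: "real ^ 'd"

definition max_edge :: "'d::finite bbs_state \<Rightarrow> real" where
  "max_edge s = Max (range (\<lambda>k. upper s $ k - lower s $ k))"

definition box_center :: "'d::finite bbs_state \<Rightarrow> real ^ 'd" where
  "box_center s = (1 / 2) *\<^sub>R (lower s + upper s)"

definition set_coord :: "real ^ 'd::finite \<Rightarrow> 'd \<Rightarrow> real \<Rightarrow> real ^ 'd" where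
  "set_coord v i a = (\<chi> k. if k = i then a else v $ k)"

definition grid_size :: nat where
  "grid_size = 15"

definition grid_value :: "'d::finite bbs_state \<Rightarrow> 'd \<Rightarrow> nat \<Rightarrow> real" where
  "grid_value s i j = lower s $ i + real j * ((upper s $ i - lower s $ i) / real grid_size)"

text \<open>
  The step is a relation rather than a function because ties in the minimization over the grid are
  broken arbitrarily.
\<close>

definition inner_step ::
  "(real ^ 'd::finite \<Rightarrow> real) \<Rightarrow> 'd \<Rightarrow> 'd bbs_state \<Rightarrow> 'd bbs_state \<Rightarrow> bool" where
  "inner_step f i s s' \<longleftrightarrow>
    (\<exists>j. is_arg_min (\<lambda>j. f (set_coord (point s) i (grid_value s i j))) (\<lambda>j. j \<in> {0..grid_size}) j \<and>
      (let R = max_edge s; c = grid_value s i j in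
        s' = \<lparr>lower = set_coord (lower s) i (max (lower s $ i) (c - R / 3)),
              upper = set_coord (upper s) i (min (upper s $ i) (c + R / 3)),
              point = set_coord (point s) i c\<rparr>))"

definition initial_state :: "real ^ 'd::finite \<Rightarrow> real ^ 'd \<Rightarrow> 'd bbs_state" where
  "initial_state l u = \<lparr>lower = l, upper = u, point = (1 / 2) *\<^sub>R (l + u)\<rparr>"

definition nth_coord :: "nat \<Rightarrow> 'd::{finite,linorder}" where
  "nth_coord i = sorted_list_of_set UNIV ! i"

text \<open>
  A run lists the states after each inner step, with \<open>S 0\<close> the initial state.  As one outer iteration
  consists of \<^term>\<open>CARD('d)\<close> inner steps, outer iteration \<open>k\<close> (counted from 0) leads from
  \<open>S (k * CARD('d))\<close> to \<open>S (Suc k * CARD('d))\<close>.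
\<close>

definition direction_bbs_run ::
  "(real ^ 'd::{finite,linorder} \<Rightarrow> real) \<Rightarrow> real ^ 'd::{finite,linorder} \<Rightarrow>
    real ^ 'd::{finite,linorder} \<Rightarrow> (nat \<Rightarrow> 'd bbs_state) \<Rightarrow> bool"
where
  "direction_bbs_run f l u S \<longleftrightarrow>
    S 0 = initial_state l u \<and>
    (\<forall>t. inner_step f (nth_coord (t mod CARD('d))) (S t) (S (Suc t)))"

lemma inner_step_total: "\<exists>s'. inner_step f i s s'"
proof -
  let ?g = "\<lambda>j. f (set_coord (point s) i (grid_value s i j))"
  obtain j where "is_arg_min ?g (\<lambda>j. j \<in> {0..grid_size}) j"
    using ex_is_arg_min_if_finite[of "{0..grid_size}" ?g] by auto
  then show ?thesis
    unfolding inner_step_def Let_def by blast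
qed

lemma direction_bbs_run_exists: "\<exists>S. direction_bbs_run f l u S"
proof -
  have "\<exists>S. \<forall>t. (t = 0 \<longrightarrow> S t = initial_state l u) \<and>
      inner_step f (nth_coord (t mod CARD('a))) (S t) (S (Suc t))"
    by (rule dependent_nat_choice) (use inner_step_total in blast)+
  then show ?thesis
    unfolding direction_bbs_run_def by blast
qed

end

theory Submission
  imports Defs
begin

text \<open>
  The maximum edge \<open>R\<close> shrinks for a simple reason: a step leaves an edge of length at most \<open>2 * R / 3\<close>,
  no edge ever grows, and an outer iteration treats every coordinate (\<open>max_edge_outer_step\<close>).  Hence
  \<open>R\<close> tends to 0, and the centers converge to the minimizer provided that all boxes contain it
  (\<open>always_contains_minimizer\<close>).  This is the real content.  The box keeps the minimizer if the
  coordinate of the new point is wrong by at most \<open>R / 3\<close>.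

  Let \<open>d\<close> be the dimension.  Comparing the chosen grid point with the one next to the minimizer shows
  that the new squared error is at most \<open>gain d\<close> times the sum of the squared errors of the other
  \<open>d - 1\<close> coordinates, plus \<open>noise d * R\<^sup>2\<close> (\<open>step_error\<close>); in high dimension this is roughly a quarter of
  their mean plus \<open>R\<^sup>2 / 900\<close>.  If those errors were at most \<open>R / 2\<close>, this would be well below
  \<open>R\<^sup>2 / 9\<close>.  The difficulty is that they were produced when \<open>R\<close> was larger: if points end up on the
  boundary of the box, \<open>R\<close> can drop to a third within \<open>d\<close> steps, and the squared errors
  relative to \<open>R\<^sup>2\<close> grow by a factor of 9.  However, \<open>R\<close> cannot drop further than that
  (\<open>max_edge_drop\<close>), and the averaging makes the coordinates treated late in a sweep more accurate than
  those treated early.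

  Both effects are balanced by a profile \<open>p\<close> of squared errors in the order of treatment, essentially
  \<open>exp (- 2 * i / d) / 9\<close> at position \<open>i\<close>: a sweep that starts with errors \<open>9 * p\<close> ends with errors below \<open>p\<close>
  (\<open>profile_supersolution\<close>).  The first sweep starts from the center of the box, with squared errors
  up to \<open>R\<^sup>2 / 4\<close>, and ends below \<open>p\<close> as well (\<open>start_profile_le_profile\<close>).  Both inequalities hold in
  every dimension, but only narrowly as the dimension grows.  Applying them to the \<open>d\<close> steps
  before any given time yields the bound \<open>R\<^sup>2 / 9\<close> (\<open>error_decay\<close>).
\<close>

section \<open>Error profiles of a sweep\<close>

text \<open>
  With \<open>D = d - 1\<close> this is \<open>2 / (8 * D - 1)\<close>: the factor by which a perturbation of relative size
  \<open>1 / (8 * D)\<close> lets the squared errors of the other \<open>D\<close> coordinates leak into the coordinate that is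
  being minimized.
\<close>

definition gain :: "nat \<Rightarrow> real" where
  "gain d = 2 / (8 * real d - 9)"

text \<open>
  Ratio of the geometric sequences \<open>p\<close> for which
  \<open>(1 + 9 * gain d) * p i + 8 * gain d * (\<Sum>j<i. p j)\<close> does not depend on \<open>i\<close>.
\<close>

definition damp :: "nat \<Rightarrow> real" where
  "damp d = (1 + gain d) / (1 + 9 * gain d)"

text \<open>
  The nearest of the 16 grid points is at distance at most \<open>R / 30\<close>, which contributes
  \<open>R\<^sup>2 / 900\<close> to the squared error.  The factor \<open>1 + gain d = (8 * D + 1) / (8 * D - 1)\<close> is the
  possible variation of the coefficient of the squared distance.
\<close>

definition noise :: "nat \<Rightarrow> real" where
  "noise d = (1 + gain d) / 900"

text \<open>
  An upper bound for the squared error of the \<open>i\<close>-th coordinate treated in a sweep, in units of the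
  squared maximum edge at the start of the sweep.  The two constants add up to \<open>1 / 9\<close>, the largest
  squared error after which the shrunken box is certain to contain the minimizer.  The constant summand
  lifts the tail of the profile above \<open>start_profile\<close>, which the geometric sequence starting at
  \<open>1 / 9\<close> does not dominate in high dimension.
\<close>

definition profile :: "nat \<Rightarrow> nat \<Rightarrow> real" where
  "profile d i = 791 / 7200 * damp d ^ i + 1 / 800"

definition start_gap :: "nat \<Rightarrow> real" where
  "start_gap d = 3 / 16 - gain d / 32 - noise d"

text \<open>
  The squared errors at the end of a sweep before which all of them are \<open>1 / 4\<close>, the worst case for
  the first sweep, where the point starts at the center of the box: the exact solution of the recursion in
  \<open>start_profile_solution\<close>.
\<close>

definition start_profile :: "nat \<Rightarrow> nat \<Rightarrow> real" where
  "start_profile d i = 1 / 4 - start_gap d * (1 + gain d) ^ i"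

lemma gain_bounds:
  assumes "d \<ge> 2"
  shows gain_pos: "0 < gain d" and gain_le: "gain d \<le> 2 / 7"
    and dim_mult_gain: "real d * gain d = 1 / 4 + 9 * gain d / 8"
proof -
  have "real d \<ge> 2" using assms by simp
  then show "0 < gain d" "gain d \<le> 2 / 7" "real d * gain d = 1 / 4 + 9 * gain d / 8"
    by (auto simp: gain_def field_simps)
qed

lemma noise_pos: "d \<ge> 2 \<Longrightarrow> 0 < noise d"
  using gain_pos[of d] by (simp add: noise_def)

lemma damp_bounds:
  assumes "d \<ge> 2"
  shows damp_pos: "0 < damp d" and damp_less_1: "damp d < 1"
  using gain_pos[OF assms] by (auto simp: damp_def)

lemma gain_le_large:
  assumes "d \<ge> 3"
  shows "gain d \<le> 2 / 15"
proof -
  have "real d \<ge> 3" using assms by simp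
  then show ?thesis by (simp add: gain_def field_simps)
qed

text \<open>
  Since \<open>1 / damp d = (1 + v) / (1 - v)\<close> with \<open>v = 1 / (d + 1/8)\<close>, the logarithm of \<open>1 / damp d\<close> is
  \<open>2 * v\<close> up to a term of third order, which the summand \<open>1/8\<close> absorbs as soon as \<open>v\<close> is below
  \<open>1 / 3\<close>, hence for \<open>d \<ge> 3\<close>.  The bound fails for \<open>d = 2\<close>, which is therefore computed
  separately below.
\<close>

lemma damp_power_ge:
  assumes d: "d \<ge> 3"
  shows "damp d ^ d \<ge> exp (- 2)" and "damp d ^ i \<ge> exp (- 2 * real i / real d)"
proof -
  have d3: "real d \<ge> 3" using d by simp
  define w where "w = inverse (damp d)"
  define v where "v = (w - 1) / (w + 1)"
  have b: "0 < gain d" "gain d \<le> 2/15" using gain_pos[of d] gain_le_large d by auto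
  have w: "w = (1 + 9 * gain d) / (1 + gain d)" by (simp add: w_def damp_def)
  have w1: "w > 1" unfolding w using b by (simp add: field_simps)
  have v: "v = 8 / (8 * real d + 1)"
    using b d3 unfolding v_def w gain_def by (simp add: divide_simps) (simp add: algebra_simps)
  have v0: "0 < v" "v \<le> 8 / 25" using d3 by (auto simp: v field_simps)
  have ln: "ln w \<le> 2 * v + 2 * (v ^ 3 / (1 - v\<^sup>2) / 3)"
    using ln_approx_bounds[of w 1] w1 by (simp add: v_def[symmetric])
  have "v * 8 \<le> 3 * (1 - v\<^sup>2)"
  proof -
    have "v * v \<le> (8/25) * (8/25)" using v0 by (intro mult_mono) auto
    then show ?thesis using v0 by (simp add: power2_eq_square)
  qed
  moreover have vs: "1 - v\<^sup>2 > 0" using v0 calculation by (smt (verit))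
  ultimately have "v / (1 - v\<^sup>2) / 3 \<le> 1 / 8" by (simp add: field_simps)
  then have "v\<^sup>2 * (v / (1 - v\<^sup>2) / 3) \<le> v\<^sup>2 * (1 / 8)"
    by (intro mult_left_mono) auto
  moreover have "v ^ 3 / (1 - v\<^sup>2) / 3 = v\<^sup>2 * (v / (1 - v\<^sup>2) / 3)"
    by (simp add: power3_eq_cube power2_eq_square)
  ultimately have "ln w \<le> 2 * v + v\<^sup>2 / 4" using ln by linarith
  then have "real d * ln w \<le> real d * (2 * v + v\<^sup>2 / 4)" using d3 by (intro mult_left_mono) auto
  also have "\<dots> = 2 - v\<^sup>2 / 32"
  proof -
    have rd: "real d = 1 / v - 1 / 8" using d3 by (simp add: v field_simps)
    show ?thesis using v0 unfolding rd by (simp add: field_simps power2_eq_square)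
  qed
  also have "\<dots> \<le> 2" by simp
  finally have dl: "real d * ln w \<le> 2" .
  have r: "damp d = exp (- ln w)" using damp_pos[of d] d by (simp add: exp_minus w_def)
  show "damp d ^ d \<ge> exp (- 2)" using dl by (simp add: r flip: exp_of_nat_mult)
  show "damp d ^ i \<ge> exp (- 2 * real i / real d)"
  proof -
    have "ln w \<le> 2 / real d" using dl d3 by (simp add: field_simps)
    then have "real i * ln w \<le> real i * (2 / real d)" by (intro mult_left_mono) auto
    then show ?thesis by (simp add: r mult.commute flip: exp_of_nat_mult)
  qed
qed

lemma exp_neg_2_ge: "exp (- 2 :: real) \<ge> 135 / 1000"
proof -
  have "exp (2::real) = exp 1 * exp 1" by (simp flip: exp_add)
  also have "\<dots> \<le> (272/100) * (272/100)" using e_less_272 by (intro mult_mono) auto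
  finally have e: "exp (2::real) \<le> 1000 / 135" by simp
  have "inverse (exp (2::real)) \<ge> inverse (1000 / 135)"
    by (intro le_imp_inverse_le e) simp
  then show ?thesis by (simp add: exp_minus)
qed

lemma sum_profile:
  assumes "d \<ge> 2"
  shows "8 * gain d * (\<Sum>j<i. profile d j) =
    791 / 7200 * (1 + 9 * gain d) * (1 - damp d ^ i) + gain d * real i / 100"
proof -
  have b: "0 < gain d" using gain_pos assms by simp
  have r: "1 - damp d = 8 * gain d / (1 + 9 * gain d)" using b by (simp add: damp_def field_simps)
  have "(\<Sum>j<i. damp d ^ j) = (1 - damp d ^ i) / (1 - damp d)"
    using damp_less_1[OF assms] by (simp add: sum_gp_strict)
  also have "\<dots> = (1 + 9 * gain d) * (1 - damp d ^ i) / (8 * gain d)" by (simp add: r)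
  finally have "8 * gain d * (\<Sum>j<i. damp d ^ j) = (1 + 9 * gain d) * (1 - damp d ^ i)"
    using b by simp
  moreover have "(\<Sum>j<i. profile d j) = 791 / 7200 * (\<Sum>j<i. damp d ^ j) + real i / 800"
    by (simp add: profile_def sum.distrib sum_distrib_left)
  ultimately show ?thesis by (simp add: algebra_simps)
qed

text \<open>
  This is the supersolution inequality of \<open>profile_supersolution\<close> at \<open>i = 0\<close>, where it is tightest.
  For large \<open>d\<close> the geometric part contributes about \<open>(9/8) * (1 - exp (- 2)) \<approx> 0.973\<close> times its first entry; the
  small remainder pays for the grid error and for the constant summand of the profile.
\<close>

lemma profile_fits:
  assumes "d \<ge> 2"
  shows "9 * gain d * (\<Sum>j<d. profile d j) + noise d \<le> (1 + 9 * gain d) / 9"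
proof -
  define B where "B = 1 + 9 * gain d"
  have b: "0 < gain d" "gain d \<le> 2/7" using gain_pos gain_le assms by auto
  have db: "gain d * real d = 1 / 4 + 9 * gain d / 8" using dim_mult_gain[OF assms] by (simp add: mult.commute)
  have eq: "9 * gain d * (\<Sum>j<d. profile d j) =
     9/8 * (791 / 7200 * B * (1 - damp d ^ d) + (1 / 4 + 9 * gain d / 8) / 100)"
  proof -
    have "9 * gain d * (\<Sum>j<d. profile d j) = 9/8 * (8 * gain d * (\<Sum>j<d. profile d j))" by simp
    then show ?thesis by (simp only: sum_profile[OF assms] B_def db)
  qed
  show ?thesis
  proof (cases "d = 2")
    case True
    have g: "gain d = 2 / 7" by (simp add: True gain_def)
    have r: "damp d = 9 / 25" by (simp add: damp_def g)
    show ?thesis unfolding eq unfolding noise_def B_def g r unfolding True by (simp add: power2_eq_square)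
  next
    case False
    then have d3: "d \<ge> 3" using assms by simp
    have "damp d ^ d \<ge> 135/1000" using damp_power_ge(1)[OF d3] exp_neg_2_ge by linarith
    then have "(135/1000) * B \<le> B * damp d ^ d"
      using mult_left_mono[of "135/1000" "damp d ^ d" B] b by (simp add: B_def mult.commute)
    moreover have prod: "791 / 7200 * B * (1 - damp d ^ d) = 791 / 7200 * B - 791 / 7200 * (B * damp d ^ d)"
      by (simp only: right_diff_distrib mult_1_right mult.assoc)
    have "9/8 * ((791 / 7200 * C - 791 / 7200 * Y) + (1 / 4 + 9 * g / 8) / 100) + (1 + g) / 900 \<le> C / 9"
      if "0 < g" "(135/1000) * C \<le> Y" "C = 1 + 9 * g" for g C Y :: real
      using that by (simp add: field_simps)
    ultimately show ?thesis unfolding eq prod noise_def B_def[symmetric] using b(1) B_def by blast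
  qed
qed

lemma profile_0: "profile d 0 = 1 / 9"
  by (simp add: profile_def)

lemma profile_decreasing:
  assumes "d \<ge> 2" "i \<le> j"
  shows "profile d j \<le> profile d i"
  using damp_bounds[OF assms(1)] assms(2) by (auto simp: profile_def intro!: power_decreasing)

lemma sum_below_above:
  fixes p :: "nat \<Rightarrow> real"
  assumes "i < d"
  shows "(\<Sum>j<d. p j) = (\<Sum>j<i. p j) + p i + (\<Sum>j\<in>{i<..<d}. p j)"
proof -
  have "{..<d} = {..<i} \<union> {i} \<union> {i<..<d}" using assms by auto
  then show ?thesis by (simp add: sum.union_disjoint disjoint_iff)
qed

text \<open>
  Why the profile reproduces itself: in the sweep under consideration, the coordinates \<open>j < i\<close> have
  already been treated, while those with \<open>j > i\<close> still carry the errors of the previous sweep, whose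
  unit is up to \<open>9\<close> times larger because the maximum edge can drop by a factor of 3 in between.
\<close>

lemma profile_supersolution:
  assumes d: "d \<ge> 2" and i: "i < d"
  shows "gain d * ((\<Sum>j<i. profile d j) + 9 * (\<Sum>j\<in>{i<..<d}. profile d j)) + noise d \<le> profile d i"
proof -
  have b: "0 < gain d" using gain_pos d by simp
  have "791 / 7200 * (1 + 9 * gain d) * (1 - damp d ^ i)
      + (1 + 9 * gain d) * (791 / 7200 * damp d ^ i + 1 / 800) = (1 + 9 * gain d) / 9"
    by (simp add: field_simps)
  moreover have "0 \<le> gain d * real i / 100" using b by simp
  ultimately have "(1 + 9 * gain d) / 9 \<le> (1 + 9 * gain d) * profile d i + 8 * gain d * (\<Sum>j<i. profile d j)"
    unfolding sum_profile[OF d] profile_def[of d i] by linarith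
  moreover have tail: "(\<Sum>j\<in>{i<..<d}. profile d j) = (\<Sum>j<d. profile d j) - (\<Sum>j<i. profile d j) - profile d i"
    using sum_below_above[OF i, of "profile d"] by simp
  ultimately show ?thesis unfolding tail using profile_fits[OF d] by (simp add: algebra_simps)
qed

text \<open>
  The last summand counts the \<open>d - 1 - i\<close> coordinates that are still to be treated, each with squared
  error \<open>1 / 4\<close>.
\<close>

lemma start_profile_solution:
  assumes d: "d \<ge> 2"
  shows "start_profile d i = gain d * ((\<Sum>j<i. start_profile d j) + (real d - 1 - real i) / 4) + noise d"
proof (induction i)
  case 0
  have "gain d * (real d - 1) = 1 / 4 + gain d / 8" using dim_mult_gain[OF d] by (simp add: algebra_simps)
  then show ?case by (simp add: start_profile_def start_gap_def)
next
  case (Suc i)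
  have "start_profile d (Suc i) = start_profile d i + gain d * (start_profile d i - 1 / 4)"
    by (simp add: start_profile_def algebra_simps)
  also have "\<dots> = gain d * ((\<Sum>j<i. start_profile d j) + (real d - 1 - real i) / 4) + noise d
      + gain d * (start_profile d i - 1 / 4)"
    using Suc.IH by simp
  also have "\<dots> = gain d * ((\<Sum>j<Suc i. start_profile d j) + (real d - 1 - real (Suc i)) / 4) + noise d"
    by (simp add: field_simps)
  finally show ?case .
qed

lemma start_gap_eq: "start_gap d = 671 / 3600 - 233 / 7200 * gain d"
  by (simp add: start_gap_def noise_def field_simps)

lemma start_gap_pos:
  assumes "d \<ge> 2"
  shows "start_gap d > 0"
  using gain_le[OF assms] by (simp add: start_gap_eq)

text \<open>
  On average, the first \<open>k\<close> entries are at least \<open>1 / 36\<close>, so that coordinates with error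
  \<open>1 / 36\<close> each may replace them in the recursion.
\<close>

lemma sum_start_profile_ge:
  assumes d: "d \<ge> 2" and k: "k \<le> d"
  shows "real k / 36 \<le> (\<Sum>j<k. start_profile d j)"
proof -
  have b: "0 < gain d" "gain d \<le> 2/7" using gain_pos gain_le d by auto
  have D: "(real d - 1) * gain d = 1 / 4 + gain d / 8" using dim_mult_gain[OF d] by (simp add: algebra_simps)
  \<comment> \<open>The powers in \<open>start_profile\<close> stay so close to 1 that a linear bound suffices; 7/5 is the
    slope of the chord of \<open>1 / (1 - x)\<close> between 0 and 2/7.\<close>
  have pow: "(1 + gain d) ^ j \<le> 1 + 7 / 5 * (real j * gain d)" if "j < k" for j
  proof -
    define x where "x = real j * gain d"
    have "real j * gain d \<le> (real d - 1) * gain d" using that k b by (intro mult_right_mono) auto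
    then have x: "0 \<le> x" "x \<le> 2/7" using D b by (auto simp: x_def)
    have "1 - x \<le> (1 - gain d) ^ j" using Bernoulli_inequality[of "- gain d" j] b by (simp add: x_def)
    then have "(1 + gain d) ^ j * (1 - x) \<le> (1 + gain d) ^ j * (1 - gain d) ^ j"
      using b by (intro mult_left_mono) auto
    also have "\<dots> = (1 - (gain d)\<^sup>2) ^ j" by (simp add: power2_eq_square algebra_simps flip: power_mult_distrib)
    also have "\<dots> \<le> 1" using b by (intro power_le_one) (auto simp: abs_square_le_1)
    finally have "(1 + gain d) ^ j \<le> 1 / (1 - x)" using x by (simp add: field_simps)
    also have "\<dots> \<le> 1 + 7 / 5 * x"
    proof -
      have "x * x \<le> x * (2/7)" using x by (intro mult_left_mono) auto
      then show ?thesis using x by (simp add: field_simps)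
    qed
    finally show ?thesis by (simp add: x_def)
  qed
  have gauss: "(\<Sum>j<k. real j) = real k * (real k - 1) / 2"
    by (induction k) (auto simp: field_simps)
  have "(\<Sum>j<k. (1 + gain d) ^ j) \<le> (\<Sum>j<k. 1 + 7 / 5 * (real j * gain d))"
    by (intro sum_mono pow) simp
  also have "\<dots> = real k + 7 / 5 * gain d * (\<Sum>j<k. real j)"
  proof -
    have "(\<Sum>j<k. 7 / 5 * (real j * gain d)) = 7 / 5 * gain d * (\<Sum>j<k. real j)"
      unfolding sum_distrib_left by (rule sum.cong) auto
    then show ?thesis by (simp add: sum.distrib)
  qed
  also have "\<dots> = real k * (1 + 7 / 10 * ((real k - 1) * gain d))"
    unfolding gauss by (simp add: field_simps)
  also have "\<dots> \<le> real k * (1 + 7 / 10 * (1 / 4 + gain d / 8))"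
  proof -
    have "(real k - 1) * gain d \<le> (real d - 1) * gain d" using k b by (intro mult_right_mono) auto
    then have "(real k - 1) * gain d \<le> 1 / 4 + gain d / 8" using D by linarith
    then show ?thesis by (intro mult_left_mono add_left_mono) auto
  qed
  finally have s: "(\<Sum>j<k. (1 + gain d) ^ j) \<le> real k * (47 / 40 + 7 / 80 * gain d)" by (simp add: algebra_simps)
  have "start_gap d * (\<Sum>j<k. (1 + gain d) ^ j) \<le> start_gap d * (real k * (47 / 40 + 7 / 80 * gain d))"
    using start_gap_pos[OF d] by (intro mult_left_mono s) auto
  also have "\<dots> = real k * (start_gap d * (47 / 40 + 7 / 80 * gain d))" by simp
  also have "\<dots> \<le> real k * (2 / 9)"
  proof (intro mult_left_mono)
    have "0 \<le> gain d * gain d" by simp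
    then show "start_gap d * (47 / 40 + 7 / 80 * gain d) \<le> 2 / 9"
      using b unfolding start_gap_eq by (simp add: algebra_simps)
  qed simp
  finally show ?thesis
    by (simp add: start_profile_def sum_subtractf flip: sum_distrib_left)
qed

text \<open>
  In high dimension both profiles are close to functions of \<open>s = i / d\<close>, namely
  \<open>1 / 4 - a * exp (s / 4)\<close> and \<open>b * exp (- 2 * s) + 1 / 800\<close>.  In terms of \<open>y = exp (s / 4)\<close> the
  claim becomes \<open>a * y + b / y ^ 8 + 1 / 800 \<ge> 1 / 4\<close>, and replacing the convex function \<open>1 / y ^ 8\<close> by
  a tangent close to the minimum settles it.
\<close>

lemma start_profile_le_profile:
  assumes d: "d \<ge> 2" and i: "i < d"
  shows "start_profile d i \<le> profile d i"
proof (cases "d = 2")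
  case True
  then have "i = 0 \<or> i = 1" using i by auto
  then show ?thesis
    by (auto simp: True start_profile_def start_gap_def noise_def profile_def damp_def gain_def)
next
  case False
  then have d3: "d \<ge> 3" using d by simp
  then have dr: "real d \<ge> 3" by simp
  have b: "0 < gain d" "gain d \<le> 2/15" using gain_pos gain_le_large d3 d by auto
  define s where "s = real i / real d"
  define y where "y = exp (s / 4)"
  have s: "0 \<le> s" "s \<le> 1" using i by (auto simp: s_def)
  have r: "damp d ^ i \<ge> exp (- 2 * s)" using damp_power_ge(2)[OF d3, of i] by (simp add: s_def)
  have y8: "exp (- 2 * s) * y ^ 8 = 1" by (simp add: y_def flip: exp_of_nat_mult exp_add)
  have y1: "1 \<le> y" using s by (simp add: y_def)
  have kap: "start_gap d \<ge> 182 / 1000" using b unfolding start_gap_eq by simp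
  \<comment> \<open>For finite \<open>d\<close> the factor \<open>start_gap d\<close> is below its limit 671/3600.  Away from \<open>s = 0\<close>
    the powers of \<open>1 + gain d\<close> exceed \<open>y\<close> by enough to compensate for this; near \<open>s = 0\<close>
    there is room to spare.\<close>
  show ?thesis
  proof (cases "s \<le> 1 / 5")
    case True
    have "exp (- 2 * s) \<ge> exp (- (2/5))" using True by simp
    moreover have "exp (- (2/5)) = exp (- (1/5)) * exp (- (1/5) :: real)" by (simp flip: exp_add)
    moreover have "exp (- (1/5) :: real) * exp (- (1/5)) \<ge> (4/5) * (4/5)"
      using exp_ge_add_one_self[of "- (1/5) :: real"] by (intro mult_mono) auto
    ultimately have "damp d ^ i \<ge> 16/25" using r by linarith
    moreover have "start_gap d * (1 + gain d) ^ i \<ge> start_gap d * 1"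
      using b kap by (intro mult_left_mono one_le_power) auto
    ultimately show ?thesis using kap unfolding start_profile_def profile_def by linarith
  next
    case False
    define e where "e = 2 * gain d / (2 + gain d)"
    have e: "e = 1 / (4 * (real d - 1))"
    proof -
      define A where "A = real d - 1"
      define C where "C = 8 * real d - 9"
      have "A > 0" "C > 0" using dr by (auto simp: A_def C_def)
      moreover have "gain d = 2 / C" by (simp add: gain_def C_def)
      moreover have "2 + gain d = 16 * A / C" using dr by (simp add: gain_def A_def C_def field_simps)
      ultimately show ?thesis unfolding A_def[symmetric] by (simp add: e_def)
    qed
    have "ln (1 + gain d) \<ge> e"
      using ln_inverse_approx_ge[of 1 "1 + gain d"] b by (simp add: e_def)
    then have "real i * ln (1 + gain d) \<ge> real i * e" by (intro mult_left_mono) auto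
    moreover have "real i * e = s / 4 + s * e"
    proof -
      have "1 / 4 + e = real d * e" using dr by (simp add: e field_simps)
      moreover have "s / 4 + s * e = s * (1 / 4 + e)" by (simp add: distrib_left)
      ultimately show ?thesis using dr by (simp add: s_def)
    qed
    moreover have "(1 + gain d) ^ i = exp (real i * ln (1 + gain d))"
      using b by (simp add: exp_of_nat_mult)
    ultimately have "(1 + gain d) ^ i \<ge> y * exp (s * e)" by (simp add: y_def flip: exp_add)
    moreover have "y * exp (s * e) \<ge> y * (1 + s * e)" using y1 by (intro mult_left_mono) auto
    ultimately have g: "(1 + gain d) ^ i \<ge> y * (1 + s * e)" by linarith
    have e0: "0 < e" using b by (simp add: e_def)
    have se: "s * e \<ge> 1/5 * e" using False e0 by (intro mult_right_mono) auto
    have combine: "P \<ge> 671 / 3600"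
      if "P \<ge> Q" "Q = a + 1/5 * W" "W \<ge> 182/1000 * e" "e \<ge> 15/16 * g" "0 < g" "a = 671/3600 - 233/7200 * g"
      for P Q W a g :: real
      using that by simp
    have k: "start_gap d * (1 + s * e) \<ge> 671 / 3600"
    proof (rule combine)
      show "start_gap d * (1 + s * e) \<ge> start_gap d * (1 + 1/5 * e)"
        using se kap by (intro mult_left_mono) auto
      show "start_gap d * (1 + 1/5 * e) = start_gap d + 1/5 * (start_gap d * e)"
        by (simp add: algebra_simps)
      show "start_gap d * e \<ge> 182/1000 * e" using kap e0 by (intro mult_right_mono) auto
      have "e \<ge> 2 * gain d / (2 + 2/15)" unfolding e_def using b by (intro divide_left_mono) auto
      then show "e \<ge> 15/16 * gain d" by simp
    qed (use b start_gap_eq in auto)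
    have "start_gap d * (1 + gain d) ^ i \<ge> start_gap d * (y * (1 + s * e))"
      using g kap by (intro mult_left_mono) auto
    moreover have "start_gap d * (y * (1 + s * e)) = y * (start_gap d * (1 + s * e))" by simp
    moreover have "y * (start_gap d * (1 + s * e)) \<ge> y * (671 / 3600)"
      using y1 k by (intro mult_left_mono) auto
    ultimately have k2: "start_gap d * (1 + gain d) ^ i \<ge> y * (671 / 3600)" by linarith
    have y2: "y \<le> 21/16"
    proof -
      have "y \<le> exp (1/4)" using s by (simp add: y_def)
      also have "\<dots> \<le> 1 + 1/4 + (1/4)\<^sup>2" by (rule exp_bound) auto
      finally show ?thesis by (simp add: power2_eq_square)
    qed
    \<comment> \<open>Tangent at 19/16, close to the minimizer of \<open>a * y + b / y ^ 8\<close>.\<close>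
    have tangent: "exp (- 2 * s) * (19/16) ^ 8 \<ge> 9 - 8 * y / (19/16)"
    proof -
      define u where "u = y / (19/16)"
      have u: "u > 0" using y1 by (simp add: u_def)
      have "exp (- 2 * s) * (19/16) ^ 8 = 1 / u ^ 8"
        using y8 y1 by (simp add: u_def field_simps)
      also have "\<dots> = (1 / u) ^ 8" by (simp add: power_divide)
      also have "\<dots> \<ge> 9 - 8 * u"
      proof -
        have "1 + 8 * (1 / u - 1) \<le> (1 / u) ^ 8" using Bernoulli_inequality[of "1 / u - 1" 8] u by simp
        moreover have "u + 1 / u \<ge> 2"
          using u sum_squares_ge_zero[of "u - 1" 0] by (simp add: field_simps power2_eq_square)
        ultimately show ?thesis by (simp add: algebra_simps)
      qed
      finally show ?thesis by (simp add: u_def)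
    qed
    have "damp d ^ i * (19/16) ^ 8 \<ge> exp (- 2 * s) * (19/16) ^ 8" using r by (intro mult_right_mono) auto
    then have "damp d ^ i \<ge> (9 - 8 * y / (19/16)) / (19/16) ^ 8" using tangent by (simp add: field_simps)
    then show ?thesis using k2 y2 y1 unfolding start_profile_def profile_def
      by (simp add: field_simps power_divide)
  qed
qed

section \<open>Propagation of coordinate errors\<close>

text \<open>
  The squared errors are \<open>9 * u\<close> before a sweep and \<open>w\<close> after it.  In applications \<open>\<rho>\<close> is the squared
  maximum edge at the start of the sweep, and \<open>9 * \<rho>\<close> bounds its value one sweep earlier.
\<close>

lemma sweep_le_profile:
  assumes d: "d \<ge> 2"
    and rec: "\<And>i. i < d \<Longrightarrow>
      w i \<le> gain d * ((\<Sum>j<i. w j) + 9 * (\<Sum>j\<in>{i<..<d}. u j)) + noise d * \<rho>"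
    and u: "\<And>j. j < d \<Longrightarrow> u j \<le> profile d j * \<rho>"
    and \<rho>: "0 \<le> \<rho>" and i: "i < d"
  shows "w i \<le> profile d i * \<rho>"
  using i
proof (induction i rule: less_induct)
  case (less i)
  have "(\<Sum>j<i. w j) \<le> (\<Sum>j<i. profile d j * \<rho>)" using less by (intro sum_mono) auto
  moreover have "(\<Sum>j\<in>{i<..<d}. u j) \<le> (\<Sum>j\<in>{i<..<d}. profile d j * \<rho>)"
    using u by (intro sum_mono) auto
  ultimately have "(\<Sum>j<i. w j) + 9 * (\<Sum>j\<in>{i<..<d}. u j) \<le>
      ((\<Sum>j<i. profile d j) + 9 * (\<Sum>j\<in>{i<..<d}. profile d j)) * \<rho>"
    by (simp add: distrib_right flip: sum_distrib_right)
  then have "w i \<le> gain d * (((\<Sum>j<i. profile d j) + 9 * (\<Sum>j\<in>{i<..<d}. profile d j)) * \<rho>) + noise d * \<rho>"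
    using rec[OF less.prems] gain_pos[OF d] by (smt (verit) mult_left_mono)
  also have "\<dots> = (gain d * ((\<Sum>j<i. profile d j) + 9 * (\<Sum>j\<in>{i<..<d}. profile d j)) + noise d) * \<rho>"
    by (simp add: algebra_simps)
  also have "\<dots> \<le> profile d i * \<rho>"
    by (intro mult_right_mono profile_supersolution d less.prems \<rho>)
  finally show ?case .
qed

text \<open>
  Here the first \<open>k\<close> coordinates are not treated at all; they are merely known to have small errors.
  This is needed for runs that are cut into sweeps in such a way that the first one is incomplete.
\<close>

lemma sweep_le_start_profile:
  assumes d: "d \<ge> 2"
    and rec: "\<And>i. k \<le> i \<Longrightarrow> i < d \<Longrightarrow>
      w i \<le> gain d * ((\<Sum>j<i. w j) + 9 * (\<Sum>j\<in>{i<..<d}. u j)) + noise d * \<rho>"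
    and w: "\<And>j. j < k \<Longrightarrow> w j \<le> \<rho> / 36"
    and u: "\<And>j. j < d \<Longrightarrow> u j \<le> \<rho> / 36"
    and \<rho>: "0 \<le> \<rho>" and i: "k \<le> i" "i < d"
  shows "w i \<le> start_profile d i * \<rho>"
  using i
proof (induction i rule: less_induct)
  case (less i)
  have "(\<Sum>j<k. w j) \<le> (\<Sum>j<k. \<rho> / 36)" using w by (intro sum_mono) auto
  also have "\<dots> = real k / 36 * \<rho>" by simp
  also have "\<dots> \<le> (\<Sum>j<k. start_profile d j) * \<rho>"
    using less.prems by (intro mult_right_mono sum_start_profile_ge d \<rho>) auto
  also have "\<dots> = (\<Sum>j<k. start_profile d j * \<rho>)" by (simp add: sum_distrib_right)
  finally have "(\<Sum>j<k. w j) \<le> (\<Sum>j<k. start_profile d j * \<rho>)" .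
  moreover have "(\<Sum>j\<in>{k..<i}. w j) \<le> (\<Sum>j\<in>{k..<i}. start_profile d j * \<rho>)"
    using less by (intro sum_mono) auto
  moreover have "(\<Sum>j<i. f j) = (\<Sum>j<k. f j) + (\<Sum>j\<in>{k..<i}. f j)" for f :: "nat \<Rightarrow> real"
    using sum.atLeastLessThan_concat[of 0 k i f] less.prems by (simp add: atLeast0LessThan)
  ultimately have "(\<Sum>j<i. w j) \<le> (\<Sum>j<i. start_profile d j) * \<rho>"
    by (simp add: distrib_right flip: sum_distrib_right)
  moreover have "(\<Sum>j\<in>{i<..<d}. u j) \<le> (\<Sum>j\<in>{i<..<d}. \<rho> / 36)"
    using u by (intro sum_mono) auto
  moreover have "(\<Sum>j\<in>{i<..<d}. \<rho> / 36) = (real d - 1 - real i) * (\<rho> / 36)"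
    using less.prems by (simp add: of_nat_diff)
  ultimately have "(\<Sum>j<i. w j) + 9 * (\<Sum>j\<in>{i<..<d}. u j) \<le>
      (\<Sum>j<i. start_profile d j) * \<rho> + 9 * ((real d - 1 - real i) * (\<rho> / 36))"
    by linarith
  also have "\<dots> = ((\<Sum>j<i. start_profile d j) + (real d - 1 - real i) / 4) * \<rho>"
    by (simp add: field_simps)
  finally have "(\<Sum>j<i. w j) + 9 * (\<Sum>j\<in>{i<..<d}. u j) \<le>
      ((\<Sum>j<i. start_profile d j) + (real d - 1 - real i) / 4) * \<rho>" .
  then have "w i \<le> gain d * (((\<Sum>j<i. start_profile d j) + (real d - 1 - real i) / 4) * \<rho>) + noise d * \<rho>"
    using rec[OF less.prems] gain_pos[OF d] by (smt (verit) mult_left_mono)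
  also have "\<dots> = (gain d * ((\<Sum>j<i. start_profile d j) + (real d - 1 - real i) / 4) + noise d) * \<rho>"
    by (simp add: algebra_simps)
  also have "\<dots> = start_profile d i * \<rho>" using start_profile_solution[OF d, of i] by simp
  finally show ?case .
qed

text \<open>
  At position \<open>i\<close> of the sweep that starts at time \<open>t\<close>, the last \<open>d - 1\<close> errors consist of those of the
  previous sweep at later positions and those of the current sweep at earlier positions.
\<close>

lemma sum_shifted_window:
  fixes v :: "nat \<Rightarrow> real"
  assumes "i < d"
  shows "(\<Sum>j\<in>{1..<d}. v (t + i + j)) = (\<Sum>j\<in>{i<..<d}. v (t + j)) + (\<Sum>j<i. v (t + d + j))"
proof -
  have "(\<Sum>j\<in>{1..<d}. v (t + i + j)) = (\<Sum>j\<in>{Suc i..<i + d}. v (t + j))"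
    using sum.shift_bounds_nat_ivl[of "\<lambda>j. v (t + j)" 1 i d] by (simp add: add_ac)
  also have "\<dots> = (\<Sum>j\<in>{Suc i..<d}. v (t + j)) + (\<Sum>j\<in>{d..<i + d}. v (t + j))"
    using assms by (simp add: sum.atLeastLessThan_concat)
  also have "(\<Sum>j\<in>{d..<i + d}. v (t + j)) = (\<Sum>j<i. v (t + d + j))"
    using sum.shift_bounds_nat_ivl[of "\<lambda>j. v (t + j)" 0 d i] by (simp add: add_ac atLeast0LessThan)
  also have "{Suc i..<d} = {i<..<d}" by auto
  finally show ?thesis .
qed

text \<open>
  The heart of the convergence proof, free of geometry.  \<open>v (t + d)\<close> is the squared error of the
  coordinate treated in step \<open>t\<close> right after that step, and \<open>v 0, \<dots>, v (d - 1)\<close> are the initial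
  squared errors.

  An induction on the claim itself does not close.  It would bound the errors of the other coordinates by
  a third of the maximum edge when they were treated, but the maximum edge may have dropped by a factor
  of 3 since then, and a quarter of the resulting mean square \<open>(R t)\<^sup>2\<close> exceeds \<open>(R t)\<^sup>2 / 9\<close>.  The
  stronger induction hypothesis \<open>G\<close> says that the errors of the sweep starting at an arbitrary time \<open>t\<close>
  follow \<open>profile\<close>, with unit \<open>(R t)\<^sup>2\<close>.  As the sweep may start anywhere, it does not matter when
  \<open>R\<close> drops: the claim for step \<open>t\<close> is read off at the first position of the sweep starting at \<open>t\<close>.
\<close>

lemma error_decay:
  fixes v R :: "nat \<Rightarrow> real"
  assumes d: "d \<ge> 2"
    and R0: "\<And>t. 0 \<le> R t" and R_mono: "\<And>t. R (Suc t) \<le> R t"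
    and R_drop: "\<And>t. R t \<le> 3 * R (t + d)"
    and start: "\<And>n. n < d \<Longrightarrow> v n \<le> (R n)\<^sup>2 / 4"
    and rec: "\<And>t. v (t + d) \<le> gain d * (\<Sum>j\<in>{1..<d}. v (t + j)) + noise d * (R t)\<^sup>2"
  shows "v (t + d) \<le> (R t)\<^sup>2 / 9"
proof -
  have anti: "R n \<le> R m" if "m \<le> n" for m n using lift_Suc_antimono_le[of R m n] R_mono that by blast
  have anti2: "(R n)\<^sup>2 \<le> (R m)\<^sup>2" if "m \<le> n" for m n using anti[OF that] R0 by (intro power_mono) auto
  have drop2: "(R t)\<^sup>2 \<le> 9 * (R (t + d))\<^sup>2" for t
    using power_mono[OF R_drop[of t] R0[of t], of 2] by (simp add: power_mult_distrib)
  have recw: "v (t + d + i) \<le> gain d * ((\<Sum>j<i. v (t + d + j)) + 9 * (\<Sum>j\<in>{i<..<d}. v (t + j) / 9)) + noise d * (R t)\<^sup>2"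
    if "i < d" for t i
  proof -
    have "v (t + i + d) \<le> gain d * (\<Sum>j\<in>{1..<d}. v (t + i + j)) + noise d * (R (t + i))\<^sup>2"
      by (rule rec)
    also have "\<dots> \<le> gain d * (\<Sum>j\<in>{1..<d}. v (t + i + j)) + noise d * (R t)\<^sup>2"
      using noise_pos[OF d] anti2[of t "t + i"] by simp
    finally show ?thesis unfolding sum_shifted_window[OF that] by (simp add: add_ac flip: sum_divide_distrib)
  qed
  \<comment> \<open>\<open>H t\<close> is what the sweep starting at \<open>t\<close> needs to know about the previous one.\<close>
  define H where "H t \<longleftrightarrow> (\<forall>i<d. t + i \<ge> d \<longrightarrow> v (t + i) \<le> profile d i * (9 * (R t)\<^sup>2))" for t
  define G where "G t \<longleftrightarrow> (\<forall>i<d. v (t + d + i) \<le> profile d i * (R t)\<^sup>2)" for t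
  have base: "H t" if "t < d" for t
    unfolding H_def
  proof (intro allI impI)
    fix i assume i: "i < d" "d \<le> t + i"
    \<comment> \<open>The previous sweep would start at the negative time \<open>t - d\<close>, so its first \<open>d - t\<close> positions
      hold coordinates that are untreated at time \<open>t\<close>.  Their errors are at most half of the
      current maximum edge, that is, \<open>\<rho> / 36\<close> after squaring.\<close>
    define \<rho> where "\<rho> = 9 * (R t)\<^sup>2"
    have R0t: "(R 0)\<^sup>2 \<le> \<rho>" using drop2[of 0] anti2[of t d] that by (simp add: \<rho>_def)
    have "v (t + i) \<le> start_profile d i * \<rho>"
    proof (rule sweep_le_start_profile[where k = "d - t" and w = "\<lambda>i. v (t + i)" and u = "\<lambda>j. if j < d - t then \<rho> / 36 else v (t + j - d) / 9"])
      fix i assume i: "d - t \<le> i" "i < d"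
      define s where "s = t + i - d"
      have s: "t + i = s + d" "s < t" using i that by (auto simp: s_def)
      have "v (s + d) \<le> gain d * (\<Sum>j\<in>{1..<d}. v (s + j)) + noise d * (R s)\<^sup>2"
        by (rule rec)
      also have "\<dots> \<le> gain d * (\<Sum>j\<in>{1..<d}. v (s + j)) + noise d * \<rho>"
        using noise_pos[OF d] anti2[of 0 s] R0t by simp
      also have "(\<Sum>j\<in>{1..<d}. v (s + j)) = (\<Sum>j\<in>{1..<d - i}. v (s + j)) + (\<Sum>j\<in>{d - i..<d}. v (s + j))"
        using i by (simp add: sum.atLeastLessThan_concat)
      also have "(\<Sum>j\<in>{d - i..<d}. v (s + j)) = (\<Sum>j<i. v (t + j))"
        using sum.shift_bounds_nat_ivl[of "\<lambda>j. v (s + j)" 0 "d - i" i] i s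
        by (simp add: atLeast0LessThan s_def add_ac)
      also have "(\<Sum>j\<in>{1..<d - i}. v (s + j)) = 9 * (\<Sum>j\<in>{i<..<d}. if j < d - t then \<rho> / 36 else v (t + j - d) / 9)"
      proof -
        have "(\<Sum>j\<in>{i<..<d}. if j < d - t then \<rho> / 36 else v (t + j - d) / 9) = (\<Sum>j\<in>{i<..<d}. v (t + j - d) / 9)"
          using i by (intro sum.cong) auto
        also have "\<dots> = (\<Sum>j\<in>{1 + i..<(d - i) + i}. v (t + j - d)) / 9"
          using i by (simp add: sum_divide_distrib) (rule sum.cong, auto)
        also have "\<dots> = (\<Sum>j\<in>{1..<d - i}. v (s + j)) / 9"
          unfolding sum.shift_bounds_nat_ivl using i that by (simp add: s_def add_ac)
        finally show ?thesis by simp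
      qed
      finally show "v (t + i) \<le> gain d * ((\<Sum>j<i. v (t + j)) + 9 * (\<Sum>j\<in>{i<..<d}. if j < d - t then \<rho> / 36 else v (t + j - d) / 9)) + noise d * \<rho>"
        unfolding s(1) by (simp only: add.commute add.left_commute)
    next
      fix j assume "j < d - t"
      then have "v (t + j) \<le> (R (t + j))\<^sup>2 / 4" by (intro start) auto
      then show "v (t + j) \<le> \<rho> / 36" using anti2[of t "t + j"] by (simp add: \<rho>_def)
    next
      fix j assume j: "j < d"
      have "t + j - d < d" using j that by linarith
      then show "(if j < d - t then \<rho> / 36 else v (t + j - d) / 9) \<le> \<rho> / 36"
        using start[of "t + j - d"] anti2[of 0 "t + j - d"] R0t by auto
    qed (use d i R0 in \<open>auto simp: \<rho>_def\<close>)
    also have "\<dots> \<le> profile d i * \<rho>" using i d by (intro mult_right_mono start_profile_le_profile) (auto simp: \<rho>_def)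
    finally show "v (t + i) \<le> profile d i * (9 * (R t)\<^sup>2)" by (simp add: \<rho>_def)
  qed
  have step: "G t" if H: "H t" for t
  proof -
    define \<rho> where "\<rho> = (R t)\<^sup>2"
    have \<rho>: "0 \<le> \<rho>" by (simp add: \<rho>_def)
    have early: "v (t + j) / 9 \<le> 1 / 36 * \<rho>" if "t + j < d" for j
      using start[OF that] anti2[of t "t + j"] by (simp add: \<rho>_def)
    have late: "v (t + j) / 9 \<le> profile d j * \<rho>" if "d \<le> t + j" "j < d" for j
      using H that by (auto simp: H_def \<rho>_def)
    \<comment> \<open>The errors before the sweep are bounded by the profile or, for untreated coordinates, which come
      first, by 1/36.  As the profile is decreasing, one of the two bounds holds for all of them.\<close>
    consider "d \<le> t \<or> profile d (d - t - 1) \<ge> 1 / 36" | "t < d" "profile d (d - t - 1) < 1 / 36" by linarith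
    then show ?thesis
    proof cases
      case 1
      have "v (t + j) / 9 \<le> profile d j * \<rho>" if "j < d" for j
      proof (cases "t + j < d")
        case True
        then have "j \<le> d - t - 1" by linarith
        then have "1 / 36 \<le> profile d j" using 1 True profile_decreasing[OF d, of j "d - t - 1"] by linarith
        then have "1 / 36 * \<rho> \<le> profile d j * \<rho>" by (intro mult_right_mono \<rho>)
        then show ?thesis using early[OF True] by linarith
      qed (use late that in auto)
      then have "v (t + d + i) \<le> profile d i * \<rho>" if "i < d" for i
        using that recw[of _ t] \<rho>
        by (intro sweep_le_profile[where u = "\<lambda>j. v (t + j) / 9" and w = "\<lambda>i. v (t + d + i)"] d) (auto simp: \<rho>_def)
      then show ?thesis by (simp add: G_def \<rho>_def)
    next
      case 2
      have "v (t + j) / 9 \<le> \<rho> / 36" if "j < d" for j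
      proof (cases "t + j < d")
        case False
        then have "d - t - 1 \<le> j" by linarith
        then have "profile d j \<le> 1 / 36" using 2 profile_decreasing[OF d, of "d - t - 1" j] by linarith
        then have "profile d j * \<rho> \<le> 1 / 36 * \<rho>" by (intro mult_right_mono \<rho>)
        then show ?thesis using late[of j] False that by simp
      qed (use early in auto)
      then have "v (t + d + i) \<le> start_profile d i * \<rho>" if "i < d" for i
        using that recw[of _ t] \<rho>
        by (intro sweep_le_start_profile[where k = 0 and u = "\<lambda>j. v (t + j) / 9" and w = "\<lambda>i. v (t + d + i)"] d) (auto simp: \<rho>_def)
      moreover have "start_profile d i * \<rho> \<le> profile d i * \<rho>" if "i < d" for i
        by (intro mult_right_mono start_profile_le_profile d that \<rho>)
      ultimately show ?thesis by (force simp: G_def \<rho>_def intro: order_trans)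
    qed
  qed
  have "H t" for t
  proof (induction t rule: less_induct)
    case (less t)
    show ?case
    proof (cases "t < d")
      case False
      then have "G (t - d)" using d by (intro step less) auto
      moreover have "(R (t - d))\<^sup>2 \<le> 9 * (R t)\<^sup>2" using drop2[of "t - d"] False by simp
      moreover have "profile d i \<ge> 0" for i using damp_pos[OF d] by (simp add: profile_def)
      ultimately show ?thesis using False
        by (fastforce simp: G_def H_def intro: order_trans mult_left_mono)
    qed (rule base)
  qed
  then have "G t" by (rule step)
  then show ?thesis using d by (auto simp: G_def profile_0 dest: spec[of _ 0])
qed

section \<open>Cyclic order of the coordinates\<close>

definition coord :: "nat \<Rightarrow> 'd::{finite,linorder}" where
  "coord t = nth_coord (t mod CARD('d))"

lemma bij_betw_nth_coord: "bij_betw nth_coord {..<CARD('d)} (UNIV :: 'd::{finite,linorder} set)"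
  unfolding nth_coord_def[abs_def] by (rule bij_betw_nth) auto

lemma coord_eq_iff: "(coord s :: 'd::{finite,linorder}) = coord t \<longleftrightarrow> s mod CARD('d) = t mod CARD('d)"
proof -
  have "inj_on (nth_coord :: nat \<Rightarrow> 'd) {..<CARD('d)}"
    using bij_betw_nth_coord by (rule bij_betw_imp_inj_on)
  then show ?thesis by (simp add: coord_def inj_on_eq_iff)
qed

lemma coord_neq_window:
  assumes "s < t" "t < s + CARD('d)"
  shows "(coord s :: 'd::{finite,linorder}) \<noteq> coord t"
proof
  assume "(coord s :: 'd) = coord t"
  then have "CARD('d) dvd t - s" using assms(1)
    using mod_eq_dvd_iff_nat[of s t "CARD('d)"] by (simp add: coord_eq_iff)
  then show False using assms by (auto dest: dvd_imp_le)
qed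

lemma coord_add_card: "coord (t + CARD('d)) = (coord t :: 'd::{finite,linorder})"
  by (simp add: coord_eq_iff)

lemma bij_betw_coord_window:
  "bij_betw (\<lambda>j. coord (t + j)) {1..<CARD('d)} (UNIV - {coord t :: 'd::{finite,linorder}})"
proof -
  let ?g = "\<lambda>j. coord (t + j) :: 'd"
  have inj: "inj_on ?g {..<CARD('d)}"
  proof (rule linorder_inj_onI)
    fix i j assume "i < j" "i \<in> {..<CARD('d)}" "j \<in> {..<CARD('d)}"
    then show "?g i \<noteq> ?g j" by (intro coord_neq_window) auto
  qed auto
  then have "card (?g ` {..<CARD('d)}) = CARD('d)" by (simp add: card_image)
  then have "?g ` {..<CARD('d)} = UNIV" by (intro card_subset_eq) auto
  then have "bij_betw ?g {..<CARD('d)} UNIV" using inj by (simp add: bij_betw_def)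
  then have "bij_betw ?g ({..<CARD('d)} - {0}) (UNIV - {?g 0})"
    by (intro bij_betw_DiffI) (auto simp: bij_betw_def)
  moreover have "{..<CARD('d)} - {0} = {1..<CARD('d)}" by auto
  ultimately show ?thesis by simp
qed

lemma exists_coord_window: "\<exists>s. t \<le> s \<and> s < t + CARD('d) \<and> coord s = (k :: 'd::{finite,linorder})"
proof (cases "k = coord t")
  case True
  then show ?thesis by (auto intro!: exI[of _ t])
next
  case False
  then obtain j where "j \<in> {1..<CARD('d)}" "k = coord (t + j)"
    using bij_betw_imp_surj_on[OF bij_betw_coord_window[of t, where 'd='d]] by blast
  then show ?thesis by (intro exI[of _ "t + j"]) auto
qed

section \<open>Boxes and grids\<close>

lemma edge_le_max_edge: "upper s $ k - lower s $ k \<le> max_edge s"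
  unfolding max_edge_def by (intro Max_ge) auto

lemma max_edge_le: "(\<And>k. upper s $ k - lower s $ k \<le> a) \<Longrightarrow> max_edge s \<le> a"
  unfolding max_edge_def by (subst Max_le_iff) auto

lemma max_edge_attained: "\<exists>k. upper s $ k - lower s $ k = max_edge s"
proof -
  have "max_edge s \<in> range (\<lambda>k. upper s $ k - lower s $ k)"
    unfolding max_edge_def by (intro Max_in) auto
  then show ?thesis by auto
qed

lemma set_coord_nth [simp]: "set_coord v i a $ k = (if k = i then a else v $ k)"
  by (simp add: set_coord_def)

lemma grid_value_bounds:
  assumes "lower s $ i \<le> upper s $ i" "j \<le> grid_size"
  shows "lower s $ i \<le> grid_value s i j" "grid_value s i j \<le> upper s $ i"
proof -
  have "real j * ((upper s $ i - lower s $ i) / 15) \<le> 15 * ((upper s $ i - lower s $ i) / 15)"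
    using assms by (intro mult_right_mono) (auto simp: grid_size_def)
  then show "grid_value s i j \<le> upper s $ i" by (simp add: grid_value_def grid_size_def)
  show "lower s $ i \<le> grid_value s i j" using assms by (simp add: grid_value_def)
qed

lemma grid_value_near:
  assumes "lower s $ i \<le> a" "a \<le> upper s $ i"
  shows "\<exists>j\<le>grid_size. \<bar>grid_value s i j - a\<bar> \<le> (upper s $ i - lower s $ i) / 30"
proof (cases "lower s $ i = upper s $ i")
  case True
  then show ?thesis using assms by (intro exI[of _ 0]) (auto simp: grid_value_def)
next
  case False
  define h where "h = (upper s $ i - lower s $ i) / 15"
  define y where "y = (a - lower s $ i) / h"
  have h: "h > 0" using False assms by (simp add: h_def)
  have y: "0 \<le> y" "y \<le> 15" using h assms by (auto simp: y_def h_def field_simps)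
  define j where "j = nat \<lfloor>y + 1 / 2\<rfloor>"
  have j: "real j \<le> y + 1 / 2" "y - 1 / 2 < real j" using y unfolding j_def by linarith+
  then have "j \<le> grid_size" using y by (simp add: grid_size_def)
  moreover have "\<bar>real j - y\<bar> \<le> 1 / 2" using j by linarith
  then have "\<bar>real j - y\<bar> * h \<le> 1 / 2 * h" using h by (intro mult_right_mono) auto
  moreover have "\<bar>grid_value s i j - a\<bar> = \<bar>real j - y\<bar> * h"
  proof -
    have "y * h = a - lower s $ i" using h by (simp add: y_def)
    then have "grid_value s i j - a = (real j - y) * h"
      by (simp add: grid_value_def grid_size_def h_def[symmetric] left_diff_distrib)
    then show ?thesis using h by (simp add: abs_mult)
  qed
  moreover have "1 / 2 * h = (upper s $ i - lower s $ i) / 30" by (simp add: h_def)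
  ultimately show ?thesis by (intro exI[of _ j]) simp
qed

lemma inner_stepE:
  assumes "inner_step f i s s'"
  obtains j where "j \<le> grid_size"
    "\<And>j'. j' \<le> grid_size \<Longrightarrow>
      f (set_coord (point s) i (grid_value s i j)) \<le> f (set_coord (point s) i (grid_value s i j'))"
    "lower s' = set_coord (lower s) i (max (lower s $ i) (grid_value s i j - max_edge s / 3))"
    "upper s' = set_coord (upper s) i (min (upper s $ i) (grid_value s i j + max_edge s / 3))"
    "point s' = set_coord (point s) i (grid_value s i j)"
  using assms unfolding inner_step_def Let_def is_arg_min_def
  by (auto simp: not_less)

section \<open>Edge lengths along a run\<close>

locale bbs_run =
  fixes f :: "real ^ 'd::{finite,linorder} \<Rightarrow> real"
    and l u :: "real ^ 'd::{finite,linorder}"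
    and S :: "nat \<Rightarrow> 'd bbs_state"
  assumes run: "direction_bbs_run f l u S"
    and nonempty: "cbox l u \<noteq> {}"
begin

abbreviation R :: "nat \<Rightarrow> real" where
  "R t \<equiv> max_edge (S t)"

abbreviation edge :: "nat \<Rightarrow> 'd \<Rightarrow> real" where
  "edge t k \<equiv> upper (S t) $ k - lower (S t) $ k"

lemma step: "inner_step f (coord t) (S t) (S (Suc t))"
  using run by (auto simp: direction_bbs_run_def coord_def)

lemma initial: "S 0 = initial_state l u"
  using run by (auto simp: direction_bbs_run_def)

lemma point_in_box:
  "l $ k \<le> lower (S t) $ k \<and> lower (S t) $ k \<le> point (S t) $ k \<and>
    point (S t) $ k \<le> upper (S t) $ k \<and> upper (S t) $ k \<le> u $ k"
proof (induction t arbitrary: k)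
  case 0
  have "l $ k \<le> u $ k" using nonempty by (auto simp: interval_ne_empty_cart)
  then show ?case by (simp add: initial initial_state_def)
next
  case (Suc t)
  obtain j where j: "j \<le> grid_size"
    "lower (S (Suc t)) = set_coord (lower (S t)) (coord t) (max (lower (S t) $ coord t) (grid_value (S t) (coord t) j - R t / 3))"
    "upper (S (Suc t)) = set_coord (upper (S t)) (coord t) (min (upper (S t) $ coord t) (grid_value (S t) (coord t) j + R t / 3))"
    "point (S (Suc t)) = set_coord (point (S t)) (coord t) (grid_value (S t) (coord t) j)"
    using step[of t] by (elim inner_stepE) blast
  have "R t \<ge> 0" using edge_le_max_edge[of "S t" k] Suc.IH[of k] by linarith
  moreover have "lower (S t) $ coord t \<le> upper (S t) $ coord t" using Suc.IH[of "coord t"] by linarith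
  ultimately show ?case
    using Suc.IH[of k] grid_value_bounds[OF _ j(1), of "S t" "coord t"] by (auto simp: j)
qed

lemma edge_nonneg: "0 \<le> edge t k"
  using point_in_box[of k t] by linarith

lemma max_edge_nonneg: "0 \<le> R t"
  using edge_le_max_edge[of "S t"] edge_nonneg[of t] order_trans by blast

lemma unchanged_step:
  assumes "k \<noteq> coord t"
  shows "lower (S (Suc t)) $ k = lower (S t) $ k" "upper (S (Suc t)) $ k = upper (S t) $ k"
    "point (S (Suc t)) $ k = point (S t) $ k"
  using step[of t] assms by (auto elim!: inner_stepE)

lemma unchanged_between:
  assumes "t \<le> t'" "\<And>s. t \<le> s \<Longrightarrow> s < t' \<Longrightarrow> coord s \<noteq> k"
  shows "lower (S t') $ k = lower (S t) $ k \<and> upper (S t') $ k = upper (S t) $ k \<and>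
    point (S t') $ k = point (S t) $ k"
  using assms
proof (induction t' rule: dec_induct)
  case (step n)
  then show ?case using unchanged_step[of k n] by (metis less_Suc_eq)
qed simp

lemma edge_decreasing: "edge (Suc t) k \<le> edge t k"
proof (cases "k = coord t")
  case True
  then show ?thesis using step[of t] by (auto elim!: inner_stepE)
qed (simp add: unchanged_step)

lemma edge_after_step: "edge (Suc t) (coord t) \<le> 2 / 3 * R t"
  using step[of t] by (auto elim!: inner_stepE simp: min_def max_def)

text \<open>
  The new edge contains the part of the old one within distance \<open>R t / 3\<close> of a point of the old one,
  so it has at least this length.
\<close>

lemma longest_edge_after_step:
  assumes "edge t (coord t) = R t"
  shows "R t / 3 \<le> edge (Suc t) (coord t)"
proof -
  obtain j where j: "j \<le> grid_size"
    "lower (S (Suc t)) = set_coord (lower (S t)) (coord t) (max (lower (S t) $ coord t) (grid_value (S t) (coord t) j - R t / 3))"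
    "upper (S (Suc t)) = set_coord (upper (S t)) (coord t) (min (upper (S t) $ coord t) (grid_value (S t) (coord t) j + R t / 3))"
    using step[of t] by (elim inner_stepE) blast
  show ?thesis
    using grid_value_bounds[OF _ j(1), of "S t" "coord t"] edge_nonneg[of t "coord t"] assms max_edge_nonneg[of t]
    by (auto simp: j max_def min_def)
qed

lemma max_edge_Suc: "R (Suc t) \<le> R t"
  by (intro max_edge_le) (meson edge_decreasing edge_le_max_edge order_trans)

lemma max_edge_antimono: "t \<le> t' \<Longrightarrow> R t' \<le> R t"
  using lift_Suc_antimono_le[of R] max_edge_Suc by blast

lemma edge_antimono: "t \<le> t' \<Longrightarrow> edge t' k \<le> edge t k"
  using lift_Suc_antimono_le[of "\<lambda>t. edge t k"] edge_decreasing by blast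

text \<open>
  Within an outer iteration each coordinate is treated once, which leaves an edge of at most
  \<open>2 / 3\<close> of the maximum edge at that time.
\<close>

lemma max_edge_outer_step: "R (t + CARD('d)) \<le> 2 / 3 * R t"
proof (rule max_edge_le)
  fix k :: 'd
  obtain s where s: "t \<le> s" "s < t + CARD('d)" "coord s = k"
    using exists_coord_window[of t k] by auto
  have "edge (t + CARD('d)) k \<le> edge (Suc s) k" using s by (intro edge_antimono) auto
  also have "\<dots> \<le> 2 / 3 * R s" using edge_after_step[of s] s by simp
  also have "\<dots> \<le> 2 / 3 * R t" using max_edge_antimono[of t s] s by simp
  finally show "edge (t + CARD('d)) k \<le> 2 / 3 * R t" .
qed

text \<open>
  The longest edge keeps its length until its coordinate is treated, which happens only once within
  \<open>d\<close> steps and leaves at least a third of it.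
\<close>

lemma max_edge_drop: "R t \<le> 3 * R (t + CARD('d))"
proof -
  obtain k where k: "edge t k = R t" using max_edge_attained by blast
  obtain s where s: "t \<le> s" "s < t + CARD('d)" "coord s = k"
    using exists_coord_window[of t k] by auto
  have "coord s' \<noteq> k" if "t \<le> s'" "s' < s" for s'
    using coord_neq_window[of s' s, where 'd='d] that s by auto
  then have "edge s k = R t" using unchanged_between[of t s k] s k by auto
  moreover have "edge s k \<le> R s" "R s \<le> R t" using edge_le_max_edge max_edge_antimono s by auto
  ultimately have "R t / 3 \<le> edge (Suc s) k" using longest_edge_after_step[of s] s by simp
  moreover have "coord s' \<noteq> k" if "Suc s \<le> s'" "s' < t + CARD('d)" for s'
    using coord_neq_window[of s s', where 'd='d] that s by auto
  then have "edge (t + CARD('d)) k = edge (Suc s) k"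
    using unchanged_between[of "Suc s" "t + CARD('d)" k] s by auto
  ultimately show ?thesis using edge_le_max_edge[of "S (t + CARD('d))" k] by linarith
qed

lemma max_edge_tendsto_0: "R \<longlonglongrightarrow> 0"
proof (rule LIMSEQ_I)
  fix e :: real assume e: "0 < e"
  have geometric: "R (k * CARD('d)) \<le> (2 / 3) ^ k * R 0" for k
  proof (induction k)
    case (Suc k)
    then show ?case using max_edge_outer_step[of "k * CARD('d)"] by (simp add: add.commute)
  qed simp
  have "(\<lambda>k. (2 / 3) ^ k * R 0) \<longlonglongrightarrow> 0 * R 0"
    by (intro tendsto_mult LIMSEQ_power_zero tendsto_const) auto
  then obtain k where "(2 / 3) ^ k * R 0 < e"
    using order_tendstoD(2)[of _ 0 sequentially e] e by (auto simp: eventually_sequentially)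
  then have "R n < e" if "k * CARD('d) \<le> n" for n
    using geometric[of k] max_edge_antimono[OF that] by linarith
  then show "\<exists>no. \<forall>n\<ge>no. norm (R n - 0) < e" using max_edge_nonneg by auto
qed

end

section \<open>Perturbed quadratic functions\<close>

locale bbs_run_quadratic = bbs_run f l u S
  for f :: "real ^ 'd::{finite,linorder} \<Rightarrow> real"
    and l u :: "real ^ 'd::{finite,linorder}"
    and S :: "nat \<Rightarrow> 'd bbs_state" +
  fixes xstar :: "real ^ 'd::{finite,linorder}"
    and \<delta> :: "real ^ 'd::{finite,linorder} \<Rightarrow> real"
    and M :: real
  assumes dim: "CARD('d) \<ge> 2"
    and M: "M > 0"
    and minimizer_in_box: "xstar \<in> cbox l u"
    and quadratic: "\<And>x. x \<in> cbox l u \<Longrightarrow> f x - f xstar = (M / 2 + \<delta> x) * (norm (x - xstar))\<^sup>2"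
    and perturbation: "\<And>x. x \<in> cbox l u \<Longrightarrow> \<bar>\<delta> x\<bar> \<le> M / (16 * (real CARD('d) - 1))"
begin

definition contains_minimizer :: "nat \<Rightarrow> bool" where
  "contains_minimizer t \<longleftrightarrow> (\<forall>k. lower (S t) $ k \<le> xstar $ k \<and> xstar $ k \<le> upper (S t) $ k)"

definition off_axis :: "nat \<Rightarrow> real" where
  "off_axis t = (\<Sum>k\<in>UNIV - {coord t}. (point (S t) $ k - xstar $ k)\<^sup>2)"

lemma norm_set_coord:
  "(norm (set_coord (point (S t)) (coord t) a - xstar))\<^sup>2 = off_axis t + (a - xstar $ coord t)\<^sup>2"
proof -
  have "(norm (set_coord (point (S t)) (coord t) a - xstar))\<^sup>2 =
      (\<Sum>k\<in>UNIV. (set_coord (point (S t)) (coord t) a $ k - xstar $ k)\<^sup>2)"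
    by (simp only: power2_norm_eq_inner inner_vec_def) (simp add: power2_eq_square)
  also have "\<dots> = (a - xstar $ coord t)\<^sup>2 +
      (\<Sum>k\<in>UNIV - {coord t}. (set_coord (point (S t)) (coord t) a $ k - xstar $ k)\<^sup>2)"
    by (subst sum.remove[of _ "coord t"]) auto
  also have "(\<Sum>k\<in>UNIV - {coord t}. (set_coord (point (S t)) (coord t) a $ k - xstar $ k)\<^sup>2) = off_axis t"
    unfolding off_axis_def by (rule sum.cong) auto
  finally show ?thesis by simp
qed

text \<open>
  Compare the chosen grid point with the one closest to the minimizer.  Writing \<open>T\<close> for \<open>off_axis t\<close>, and \<open>E\<close>
  and \<open>E'\<close> for the squared errors of these two in the current coordinate, the optimality of the
  choice gives \<open>(8 * D - 1) * (T + E) \<le> (8 * D + 1) * (T + E')\<close> with \<open>D = d - 1\<close>, because the coefficient of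
  the squared distance varies by at most the factor \<open>(8 * D + 1) / (8 * D - 1)\<close>.
\<close>

lemma step_error:
  assumes "contains_minimizer t"
  shows "(point (S (Suc t)) $ coord t - xstar $ coord t)\<^sup>2 \<le>
    gain CARD('d) * off_axis t + noise CARD('d) * (R t)\<^sup>2"
proof -
  define i where "i = (coord t :: 'd)"
  define D where "D = real CARD('d) - 1"
  define T where "T = off_axis t"
  have D: "D \<ge> 1" using dim by (simp add: D_def)
  define \<rho> where "\<rho> = (R t)\<^sup>2 / 900"
  have T: "T \<ge> 0" by (simp add: T_def off_axis_def sum_nonneg)
  obtain j where j: "j \<le> grid_size"
    and best: "\<And>j'. j' \<le> grid_size \<Longrightarrow>
      f (set_coord (point (S t)) i (grid_value (S t) i j)) \<le> f (set_coord (point (S t)) i (grid_value (S t) i j'))"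
    and pt: "point (S (Suc t)) = set_coord (point (S t)) i (grid_value (S t) i j)"
    using step[of t] unfolding i_def by (elim inner_stepE) blast
  obtain j' where j': "j' \<le> grid_size" "\<bar>grid_value (S t) i j' - xstar $ i\<bar> \<le> edge t i / 30"
    using grid_value_near[of "S t" i "xstar $ i"] assms by (auto simp: contains_minimizer_def)
  define E where "E = (grid_value (S t) i j - xstar $ i)\<^sup>2"
  define E' where "E' = (grid_value (S t) i j' - xstar $ i)\<^sup>2"
  have "E' \<le> (R t / 30)\<^sup>2"
    unfolding E'_def using j'(2) edge_le_max_edge[of "S t" i] max_edge_nonneg[of t]
    by (intro power2_le_iff_abs_le[THEN iffD2]) auto
  then have E': "E' \<le> \<rho>" by (simp add: power_divide \<rho>_def)
  have in_box: "set_coord (point (S t)) i (grid_value (S t) i n) \<in> cbox l u" if "n \<le> grid_size" for n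
    unfolding mem_box_cart using grid_value_bounds[OF _ that, of "S t" i] point_in_box[of _ t] edge_nonneg[of t i]
    by (auto intro: order_trans)
  have ge: "f (set_coord (point (S t)) i (grid_value (S t) i j)) - f xstar \<ge> (M / 2 - M / (16 * D)) * (T + E)"
  proof -
    have "M / 2 - M / (16 * D) \<le> M / 2 + \<delta> (set_coord (point (S t)) i (grid_value (S t) i j))"
      using perturbation[OF in_box[OF j]] by (simp add: D_def abs_le_iff)
    then show ?thesis
      using T quadratic[OF in_box[OF j]] norm_set_coord[of t]
      by (auto simp: i_def T_def[symmetric] E_def intro!: mult_right_mono)
  qed
  have le: "f (set_coord (point (S t)) i (grid_value (S t) i j')) - f xstar \<le> (M / 2 + M / (16 * D)) * (T + E')"
  proof -
    have "M / 2 + M / (16 * D) \<ge> M / 2 + \<delta> (set_coord (point (S t)) i (grid_value (S t) i j'))"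
      using perturbation[OF in_box[OF j'(1)]] by (simp add: D_def abs_le_iff)
    then show ?thesis
      using T quadratic[OF in_box[OF j'(1)]] norm_set_coord[of t]
      by (auto simp: i_def T_def[symmetric] E'_def intro!: mult_right_mono)
  qed
  have "(M / 2 - M / (16 * D)) * (T + E) \<le> (M / 2 + M / (16 * D)) * (T + E')"
    using ge le best[OF j'(1)] by linarith
  moreover have "M / 2 - M / (16 * D) = M / (16 * D) * (8 * D - 1)" "M / 2 + M / (16 * D) = M / (16 * D) * (8 * D + 1)"
    using D by (auto simp: field_simps)
  ultimately have "M / (16 * D) * ((8 * D - 1) * (T + E)) \<le> M / (16 * D) * ((8 * D + 1) * (T + E'))"
    by (simp only: mult.assoc)
  then have "(8 * D - 1) * (T + E) \<le> (8 * D + 1) * (T + E')"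
    using M D by (subst (asm) mult_le_cancel_left_pos) auto
  moreover have "(8 * D + 1) * E' \<le> (8 * D + 1) * \<rho>" using E' D by (intro mult_left_mono) auto
  ultimately have "(8 * D - 1) * E \<le> 2 * T + (8 * D + 1) * \<rho>" by (simp add: algebra_simps)
  then have "E \<le> (2 * T + (8 * D + 1) * \<rho>) / (8 * D - 1)" using D by (simp add: pos_le_divide_eq mult.commute)
  also have "\<dots> = gain CARD('d) * T + noise CARD('d) * (R t)\<^sup>2"
  proof -
    have g: "gain CARD('d) = 2 / (8 * D - 1)" by (simp add: gain_def D_def)
    have "noise CARD('d) = (8 * D + 1) / (8 * D - 1) / 900" using D by (simp add: noise_def g field_simps)
    then have n: "noise CARD('d) * (R t)\<^sup>2 = (8 * D + 1) / (8 * D - 1) * \<rho>" by (simp add: \<rho>_def)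
    have "(2 * T + a * \<rho>) / b = 2 / b * T + a / b * \<rho>" for a b
      by (simp add: add_divide_distrib)
    then show ?thesis unfolding g n .
  qed
  finally show ?thesis by (simp add: E_def pt T_def i_def)
qed

text \<open>
  The squared error that step \<open>n - d\<close> leaves in its coordinate; the truncated subtraction makes this
  the initial squared error of coordinate \<open>n\<close> if \<open>n < d\<close>.  With this indexing the errors of the other
  coordinates before step \<open>t\<close> are a window of consecutive terms.
\<close>

definition error :: "nat \<Rightarrow> real" where
  "error n = (point (S (Suc n - CARD('d))) $ coord n - xstar $ coord n)\<^sup>2"

lemma error_nonneg: "0 \<le> error n"
  by (simp add: error_def)

lemma error_add_card: "error (t + CARD('d)) = (point (S (Suc t)) $ coord t - xstar $ coord t)\<^sup>2"
  by (simp add: error_def coord_add_card)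

lemma off_axis_eq_window: "off_axis t = (\<Sum>j\<in>{1..<CARD('d)}. error (t + j))"
proof -
  have "off_axis t = (\<Sum>j\<in>{1..<CARD('d)}. (point (S t) $ coord (t + j) - xstar $ coord (t + j))\<^sup>2)"
    unfolding off_axis_def by (rule sum.reindex_bij_betw[symmetric, OF bij_betw_coord_window])
  also have "\<dots> = (\<Sum>j\<in>{1..<CARD('d)}. error (t + j))"
  proof (rule sum.cong)
    fix j assume j: "j \<in> {1..<CARD('d)}"
    have "coord s \<noteq> (coord (t + j) :: 'd)" if "Suc (t + j) - CARD('d) \<le> s" "s < t" for s
      using that j by (intro coord_neq_window) auto
    then have "point (S t) $ coord (t + j) = point (S (Suc (t + j) - CARD('d))) $ coord (t + j)"
      using unchanged_between[of "Suc (t + j) - CARD('d)" t "coord (t + j)"] j by auto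
    then show "(point (S t) $ coord (t + j) - xstar $ coord (t + j))\<^sup>2 = error (t + j)"
      by (simp add: error_def)
  qed simp
  finally show ?thesis .
qed

text \<open>
  An edge that has not been treated yet still has its initial length, and the initial point is its
  midpoint.
\<close>

lemma initial_error:
  assumes "n < CARD('d)"
  shows "error n \<le> (R n)\<^sup>2 / 4"
proof -
  define k where "k = (coord n :: 'd)"
  have "coord s \<noteq> k" if "s < n" for s unfolding k_def using that assms by (intro coord_neq_window) auto
  then have "edge n k = edge 0 k" using unchanged_between[of 0 n k] by auto
  moreover have "\<bar>point (S 0) $ k - xstar $ k\<bar> \<le> edge 0 k / 2"
    using minimizer_in_box by (auto simp: initial initial_state_def mem_box_cart abs_le_iff field_simps)
      (smt (verit) mem_box_cart(2) minimizer_in_box)+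
  moreover have "edge n k / 2 \<le> R n / 2" using edge_le_max_edge by (intro divide_right_mono) auto
  ultimately have "\<bar>point (S 0) $ k - xstar $ k\<bar> \<le> R n / 2" by simp
  then have "(point (S 0) $ k - xstar $ k)\<^sup>2 \<le> (R n / 2)\<^sup>2"
    using max_edge_nonneg[of n] by (intro power2_le_iff_abs_le[THEN iffD2]) auto
  then show ?thesis using assms by (simp add: error_def k_def power_divide)
qed

text \<open>
  The box of step \<open>t + 1\<close> contains the minimizer if the error left by step \<open>t\<close> is at most \<open>R t / 3\<close>.
\<close>

lemma always_contains_minimizer: "contains_minimizer t"
proof (induction t rule: less_induct)
  case (less t)
  show ?case
  proof (cases t)
    case 0
    then show ?thesis using minimizer_in_box
      by (simp add: contains_minimizer_def initial initial_state_def mem_box_cart)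
  next
    case (Suc N)
    \<comment> \<open>The recursion for the errors is only known up to step \<open>N\<close>; setting the later errors to 0 makes it
      hold at all times.\<close>
    define v where "v n = (if n \<le> N + CARD('d) then error n else 0)" for n
    have "v (N + CARD('d)) \<le> (R N)\<^sup>2 / 9"
    proof (rule error_decay[OF dim])
      fix n assume "n < CARD('d)"
      then show "v n \<le> (R n)\<^sup>2 / 4" using initial_error by (simp add: v_def)
    next
      fix t
      show "v (t + CARD('d)) \<le> gain CARD('d) * (\<Sum>j\<in>{1..<CARD('d)}. v (t + j)) + noise CARD('d) * (R t)\<^sup>2"
      proof (cases "t \<le> N")
        case True
        have "error (t + CARD('d)) \<le> gain CARD('d) * (\<Sum>j\<in>{1..<CARD('d)}. error (t + j)) + noise CARD('d) * (R t)\<^sup>2"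
          using step_error[of t] less.IH[of t] True Suc by (simp add: error_add_card off_axis_eq_window)
        moreover have "(\<Sum>j\<in>{1..<CARD('d)}. v (t + j)) = (\<Sum>j\<in>{1..<CARD('d)}. error (t + j))"
          using True by (intro sum.cong) (auto simp: v_def)
        ultimately show ?thesis using True by (simp add: v_def)
      next
        case False
        have "0 \<le> (\<Sum>j\<in>{1..<CARD('d)}. v (t + j))" by (intro sum_nonneg) (auto simp: v_def error_nonneg)
        then show ?thesis using False gain_pos[OF dim] noise_pos[OF dim] by (simp add: v_def)
      qed
    qed (auto simp: max_edge_nonneg max_edge_Suc max_edge_drop)
    then have "(point (S (Suc N)) $ coord N - xstar $ coord N)\<^sup>2 \<le> (R N / 3)\<^sup>2"
      by (simp add: v_def error_add_card power_divide)
    then have "\<bar>point (S (Suc N)) $ coord N - xstar $ coord N\<bar> \<le> R N / 3"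
      using max_edge_nonneg[of N] by (simp add: abs_le_square_iff[symmetric])
    then have close: "point (S (Suc N)) $ coord N - R N / 3 \<le> xstar $ coord N"
      "xstar $ coord N \<le> point (S (Suc N)) $ coord N + R N / 3"
      by linarith+
    obtain c where c: "lower (S (Suc N)) = set_coord (lower (S N)) (coord N) (max (lower (S N) $ coord N) (c - R N / 3))"
      "upper (S (Suc N)) = set_coord (upper (S N)) (coord N) (min (upper (S N) $ coord N) (c + R N / 3))"
      "point (S (Suc N)) = set_coord (point (S N)) (coord N) c"
      using step[of N] by (elim inner_stepE) blast
    have "contains_minimizer N" using less.IH Suc by simp
    then show ?thesis using close unfolding Suc contains_minimizer_def by (simp add: c)
  qed
qed

lemma box_center_tendsto: "(\<lambda>t. box_center (S t)) \<longlonglongrightarrow> xstar"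
proof (rule vec_tendstoI)
  fix k
  have "(\<lambda>t. box_center (S t) $ k - xstar $ k) \<longlonglongrightarrow> 0"
  proof (rule Lim_null_comparison[OF _ max_edge_tendsto_0])
    have "norm (box_center (S t) $ k - xstar $ k) \<le> R t" for t
      using always_contains_minimizer[of t] edge_le_max_edge[of "S t" k]
      by (auto simp: contains_minimizer_def box_center_def abs_le_iff field_simps) (smt (verit))+
    then show "\<forall>\<^sub>F t in sequentially. norm (box_center (S t) $ k - xstar $ k) \<le> R t" by simp
  qed
  then show "(\<lambda>t. box_center (S t) $ k) \<longlonglongrightarrow> xstar $ k" by (simp add: LIM_zero_iff)
qed

end

section \<open>Convergence\<close>

theorem theorem2:
  fixes l u xstar :: "real ^ 'd::{finite,linorder}"
    and f \<delta> :: "real ^ 'd::{finite,linorder} \<Rightarrow> real"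
    and M :: real
    and S :: "nat \<Rightarrow> 'd bbs_state"
  assumes "CARD('d) \<ge> 2"
    and "M > 0"
    and "xstar \<in> cbox l u"
    and "\<forall>x\<in>cbox l u. f xstar \<le> f x"
    and "\<forall>x\<in>cbox l u. f x - f xstar = (M / 2 + \<delta> x) * (norm (x - xstar))\<^sup>2"
    and "\<forall>x\<in>cbox l u. \<bar>\<delta> x\<bar> \<le> M / (16 * (real CARD('d) - 1))"
    and "direction_bbs_run f l u S"
  shows "(\<lambda>t. box_center (S t)) \<longlonglongrightarrow> xstar \<and>
    (\<forall>k. max_edge (S (Suc k * CARD('d))) \<le> max_edge (S (k * CARD('d))) / (3 / 2))"
proof -
  interpret bbs_run_quadratic f l u S xstar \<delta> M
    using assms by unfold_locales auto
  have "max_edge (S (Suc k * CARD('d))) \<le> max_edge (S (k * CARD('d))) / (3 / 2)" for k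
    using max_edge_outer_step[of "k * CARD('d)"] by (simp add: add.commute)
  then show ?thesis using box_center_tendsto by blast
qed

end
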